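(* For every $n \in \mathbb{N} = \{1,2,3,\dots\}$ and every union-closed family $\mathcal{F}$ with $|\bigcup \mathcal{F}| = n$, \[ D(\mathcal{F}) \geq \frac{\log_2 n}{2n}. \] Equivalently, $s_n \geq \frac{\log_2 n}{2n}$ for all $n \in \mathbb{N}$.
   Context: A union-closed family is a finite family $\mathcal{F}$ of finite sets such that $A \cup B \in \mathcal{F}$ for all $A, B \in \mathcal{F}$. Write $\bigcup \mathcal{F} := \bigcup_{A \in \mathcal{F}} A$ and, for $a \in \bigcup \mathcal{F}$, $\mathcal{F}_a := \{S \in \mathcal{F} : a \in S\}$. For a union-closed family with $n = |\bigcup\mathcal{F}| \geq 1$, its density is \[ D(\mathcal{F}) := \frac{1}{n|\mathcal{F}|} \sum_{A \in \mathcal{F}} |A| = \frac{1}{n|\mathcal{F}|}\sum_{a \in \bigcup\mathcal{F}} |\mathcal{F}_a|, \] and $s_n$ denotes the minimum of $D(\mathcal{F})$ over all union-closed families $\mathcal{F}$ with $|\bigcup\mathcal{F}| = n$. *)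

theory Defs
  imports Complex_Main
begin

definition union_closed_family :: "'a set set \<Rightarrow> bool" where
  "union_closed_family F \<longleftrightarrow>
     finite F \<and> (\<forall>A\<in>F. finite A) \<and> (\<forall>A\<in>F. \<forall>B\<in>F. A \<union> B \<in> F)"

definition members_containing :: "'a set set \<Rightarrow> 'a \<Rightarrow> 'a set set" where
  "members_containing F a = {S \<in> F. a \<in> S}"

definition family_density :: "'a set set \<Rightarrow> real" where
  "family_density F = 1 / (real (card (\<Union>F)) * real (card F)) * (\<Sum>A\<in>F. real (card A))"

(* Union-closed families are considered up to renaming of the elements, so it suffices to let the
   ground sets be sets of natural numbers; densities_invariant below confirms that a family over
   any other type contributes no further value. *)
definition densities :: "nat \<Rightarrow> real set" where
  "densities n = {family_density F | F :: nat set set. union_closed_family F \<and> card (\<Union>F) = n}"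

(* Min is only meaningful on finite nonempty sets: see finite_densities and densities_nonempty. *)
definition min_density :: "nat \<Rightarrow> real" where
  "min_density n = Min (densities n)"

lemma family_density_eq_sum_members_containing:
  assumes "union_closed_family F"
  shows "family_density F = 1 / (real (card (\<Union>F)) * real (card F)) *
           (\<Sum>a\<in>\<Union>F. real (card (members_containing F a)))"
proof -
  have fin: "finite F" "finite (\<Union>F)"
    using assms by (auto simp: union_closed_family_def)
  have "(\<Sum>A\<in>F. card A) = (\<Sum>A\<in>F. card {a \<in> \<Union>F. a \<in> A})"
    by (rule sum.cong[OF refl], rule arg_cong[where f = card]) auto
  also have "\<dots> = (\<Sum>a\<in>\<Union>F. card {A \<in> F. a \<in> A})"
    using sum.swap_restrict[OF fin, of "\<lambda>_ _. 1::nat" "\<lambda>A a. a \<in> A"] by simp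
  finally have "(\<Sum>A\<in>F. card A) = (\<Sum>a\<in>\<Union>F. card (members_containing F a))"
    by (simp add: members_containing_def)
  then have "(\<Sum>A\<in>F. real (card A)) = (\<Sum>a\<in>\<Union>F. real (card (members_containing F a)))"
    by (metis of_nat_sum)
  then show ?thesis by (simp add: family_density_def)
qed

lemma finite_densities: "finite (densities n)"
proof -
  let ?g = "\<lambda>(k, m). 1 / (real n * real m) * real k"
  have "densities n \<subseteq> ?g ` ({..2 ^ n * n} \<times> {..2 ^ n})"
  proof
    fix x assume "x \<in> densities n"
    then obtain F :: "nat set set" where F: "union_closed_family F" "card (\<Union>F) = n"
      and x: "x = family_density F" by (auto simp: densities_def)
    have fin: "finite F" "finite (\<Union>F)"
      using F by (auto simp: union_closed_family_def)
    have "card F \<le> card (Pow (\<Union>F))"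
      by (rule card_mono) (use fin in auto)
    then have m: "card F \<le> 2 ^ n" using F fin by (simp add: card_Pow)
    have "card A \<le> n" if "A \<in> F" for A
      using card_mono[OF fin(2), of A] that F by auto
    then have "(\<Sum>A\<in>F. card A) \<le> card F * n"
      using sum_bounded_above[of F card n] by simp
    also have "\<dots> \<le> 2 ^ n * n" using m by simp
    finally have k: "(\<Sum>A\<in>F. card A) \<le> 2 ^ n * n" .
    have "x = ?g (\<Sum>A\<in>F. card A, card F)"
      by (simp add: x family_density_def F)
    then show "x \<in> ?g ` ({..2 ^ n * n} \<times> {..2 ^ n})" using k m by blast
  qed
  then show ?thesis by (rule finite_subset) simp
qed

lemma densities_nonempty: "densities n \<noteq> {}"
proof -
  have "union_closed_family {{..<n}}" "card (\<Union>{{..<n}}) = n"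
    by (auto simp: union_closed_family_def)
  then show ?thesis unfolding densities_def by blast
qed

lemma densities_invariant:
  fixes F :: "'a set set"
  assumes "union_closed_family F" "card (\<Union>F) = n"
  shows "family_density F \<in> densities n"
proof -
  have fin: "finite F" "finite (\<Union>F)"
    using assms by (auto simp: union_closed_family_def)
  obtain f :: "'a \<Rightarrow> nat" where f: "inj_on f (\<Union>F)"
    using finite_imp_inj_to_nat_seg[OF fin(2)] by blast
  let ?G = "(\<lambda>A. f ` A) ` F"
  have U: "\<Union>?G = f ` \<Union>F" by auto
  have cU: "card (\<Union>?G) = card (\<Union>F)" unfolding U by (rule card_image[OF f])
  have inj: "inj_on (\<lambda>A. f ` A) F"
    using f by (auto intro!: inj_onI simp: inj_on_image_eq_iff[OF f] Sup_upper)
  have uc: "union_closed_family ?G"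
    using assms(1) by (auto simp: union_closed_family_def image_Un[symmetric])
  have "(\<Sum>A\<in>?G. real (card A)) = (\<Sum>A\<in>F. real (card (f ` A)))"
    by (simp add: sum.reindex[OF inj])
  also have "\<dots> = (\<Sum>A\<in>F. real (card A))"
    by (rule sum.cong[OF refl]) (metis Sup_upper card_image f inj_on_subset)
  finally have "family_density ?G = family_density F"
    unfolding family_density_def cU card_image[OF inj] by simp
  then show ?thesis
    unfolding densities_def using uc cU assms(2) by (metis (mono_tags, lifting) mem_Collect_eq)
qed

end

theory Submission
  imports Defs "HOL-Analysis.Convex" "HOL-Library.Disjoint_Sets"
begin

text \<open>
  Reimer's theorem bounds the average member size of a union-closed family \<open>F\<close> with \<open>m\<close> members
  and \<open>n\<close> elements from below by \<open>log 2 m / 2\<close>. Pushing the family upwards one element at a time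
  maps \<open>F\<close> by some \<open>f\<close> onto an up-closed family such that the intervals \<open>[A, f A]\<close> are pairwise
  disjoint. Disjointness and up-closure together give that the sum of the \<open>|A|\<close> is at least the sum
  of the \<open>n - |f A|\<close>, while counting the subsets covered by the intervals and using concavity of the
  logarithm shows that \<open>|A| + n - |f A|\<close> is at least \<open>log 2 m\<close> on average.

  If \<open>m \<ge> n\<close> this suffices. Otherwise, by Bondy's theorem, fewer than \<open>m\<close> elements already
  separate the members of \<open>F\<close>. Reimer's theorem applies to the trace on these elements, and each
  of the more than \<open>n - m\<close> remaining elements lies in some member, so the total size is at least
  \<open>m log 2 m / 2 + n - m \<ge> m log 2 n / 2\<close>.
\<close>

section \<open>Shifting a union-closed family upwards\<close>

definition union_closed :: "'a set set \<Rightarrow> bool" where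
  "union_closed F \<longleftrightarrow> (\<forall>A\<in>F. \<forall>B\<in>F. A \<union> B \<in> F)"

lemma union_closedD: "union_closed F \<Longrightarrow> A \<in> F \<Longrightarrow> B \<in> F \<Longrightarrow> A \<union> B \<in> F"
  by (simp add: union_closed_def)

lemma union_closed_family_iff:
  "union_closed_family F \<longleftrightarrow> finite F \<and> finite (\<Union>F) \<and> union_closed F"
  unfolding union_closed_family_def union_closed_def
  by (metis Sup_upper finite_Union finite_subset)

definition up_closed_on :: "'a set \<Rightarrow> 'a set set \<Rightarrow> bool" where
  "up_closed_on I F \<longleftrightarrow> (\<forall>i\<in>I. \<forall>A\<in>F. insert i A \<in> F)"

text \<open>
  Isolation of \<open>A\<close> in the interval \<open>[A, f A]\<close> makes these intervals disjoint when \<open>F\<close> is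
  union-closed; the condition on \<open>f A \<union> B\<close> is what lets isolation survive composition.
\<close>
definition up_shift :: "'a set set \<Rightarrow> ('a set \<Rightarrow> 'a set) \<Rightarrow> bool" where
  "up_shift F f \<longleftrightarrow>
     (\<forall>A\<in>F. A \<subseteq> f A \<and>
       (\<forall>B\<in>F. A \<subseteq> B \<longrightarrow> (B \<subseteq> f A \<longrightarrow> B = A) \<and> f A \<union> B \<in> f ` F))"

lemma up_shiftI:
  assumes "\<And>A. A \<in> F \<Longrightarrow> A \<subseteq> f A"
    and "\<And>A B. A \<in> F \<Longrightarrow> B \<in> F \<Longrightarrow> A \<subseteq> B \<Longrightarrow> B \<subseteq> f A \<Longrightarrow> B = A"
    and "\<And>A B. A \<in> F \<Longrightarrow> B \<in> F \<Longrightarrow> A \<subseteq> B \<Longrightarrow> f A \<union> B \<in> f ` F"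
  shows "up_shift F f"
  using assms by (simp add: up_shift_def)

lemma up_shift_subset: "up_shift F f \<Longrightarrow> A \<in> F \<Longrightarrow> A \<subseteq> f A"
  by (simp add: up_shift_def)

lemma up_shift_isolated:
  "up_shift F f \<Longrightarrow> A \<in> F \<Longrightarrow> B \<in> F \<Longrightarrow> A \<subseteq> B \<Longrightarrow> B \<subseteq> f A \<Longrightarrow> B = A"
  by (simp add: up_shift_def)

lemma up_shift_Un_mem:
  "up_shift F f \<Longrightarrow> A \<in> F \<Longrightarrow> B \<in> F \<Longrightarrow> A \<subseteq> B \<Longrightarrow> f A \<union> B \<in> f ` F"
  by (simp add: up_shift_def)

lemma up_shift_id: "up_shift F id"
  by (rule up_shiftI) (auto simp: Un_absorb1)

lemma up_shift_comp:
  assumes shift_f: "up_shift F f" and shift_g: "up_shift (f ` F) g"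
  shows "up_shift F (g \<circ> f)"
proof (rule up_shiftI)
  show "A \<subseteq> (g \<circ> f) A" if "A \<in> F" for A
    using up_shift_subset[OF shift_f that] up_shift_subset[OF shift_g, of "f A"] that by auto
next
  fix A B assume A: "A \<in> F" and B: "B \<in> F" "A \<subseteq> B"
  have gf: "f A \<subseteq> g (f A)" using up_shift_subset[OF shift_g] A by blast
  have Un: "f A \<union> B \<in> f ` F" by (rule up_shift_Un_mem[OF shift_f A B])
  have "g (f A) \<union> (f A \<union> B) \<in> g ` f ` F"
    using up_shift_Un_mem[OF shift_g _ Un] A by blast
  moreover have "g (f A) \<union> (f A \<union> B) = (g \<circ> f) A \<union> B" using gf by auto
  ultimately show "(g \<circ> f) A \<union> B \<in> (g \<circ> f) ` F" by (simp add: image_comp)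
  assume "B \<subseteq> (g \<circ> f) A"
  then have "f A \<union> B \<subseteq> g (f A)" using gf by simp
  then have "f A \<union> B = f A" using up_shift_isolated[OF shift_g _ Un] A by blast
  then show "B = A" using up_shift_isolated[OF shift_f A B] by blast
qed

lemma up_shift_disjoint_intervals:
  assumes shift: "up_shift F f" and union_closed: "union_closed F"
  shows "disjoint_family_on (\<lambda>A. {A..f A}) F"
  unfolding disjoint_family_on_def
proof (intro ballI impI, rule ccontr)
  fix A B assume AB: "A \<in> F" "B \<in> F" "A \<noteq> B" and "{A..f A} \<inter> {B..f B} \<noteq> {}"
  then obtain S where "A \<subseteq> S" "S \<subseteq> f A" "B \<subseteq> S" "S \<subseteq> f B" by auto
  then have "A \<union> B \<subseteq> f A" "A \<union> B \<subseteq> f B" by blast+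
  moreover have "A \<union> B \<in> F" using union_closed AB by (simp add: union_closedD)
  ultimately have "A \<union> B = A" "A \<union> B = B"
    using up_shift_isolated[OF shift] AB by blast+
  then show False using \<open>A \<noteq> B\<close> by simp
qed

lemma up_shift_eqI:
  assumes shift: "up_shift F f" and union_closed: "union_closed F"
    and AB: "A \<in> F" "B \<in> F" and between: "B \<subseteq> f A" "f A \<subseteq> f B"
  shows "A = B"
proof -
  have "f A \<in> {A..f A} \<inter> {B..f B}" using up_shift_subset[OF shift AB(1)] between by simp
  then show ?thesis
    using disjoint_family_onD[OF up_shift_disjoint_intervals[OF shift union_closed] AB] by blast
qed

lemma inj_on_up_shift:
  assumes "up_shift F f" "union_closed F"
  shows "inj_on f F"
  using up_shift_eqI[OF assms] up_shift_subset[OF assms(1)] by (simp add: inj_on_def)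

definition push_up :: "'a \<Rightarrow> 'a set set \<Rightarrow> 'a set \<Rightarrow> 'a set" where
  "push_up i F A = (if insert i A \<in> F then A else insert i A)"

lemma push_up_subset_insert: "push_up i F A \<subseteq> insert i A"
  by (auto simp: push_up_def)

lemma push_up_image: "push_up i F ` F = insert i ` F \<union> {A \<in> F. insert i A \<in> F}"
proof -
  have "insert i A \<in> push_up i F ` F" if "A \<in> F" for A
    using that by (cases "insert i A \<in> F") (force simp: push_up_def)+
  moreover have "A \<in> push_up i F ` F" if "A \<in> F" "insert i A \<in> F" for A
    using that by (force simp: push_up_def)
  ultimately show ?thesis by (auto simp: push_up_def)
qed

lemma union_closed_push_up_image:
  assumes union_closed: "union_closed F"
  shows "union_closed (push_up i F ` F)"
  unfolding union_closed_def
proof (intro ballI)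
  fix X Y assume "X \<in> push_up i F ` F" "Y \<in> push_up i F ` F"
  then obtain A B where AB: "A \<in> F" "B \<in> F"
    and X: "X = insert i A \<or> X = A \<and> insert i A \<in> F"
    and Y: "Y = insert i B \<or> Y = B \<and> insert i B \<in> F"
    unfolding push_up_image by blast
  have "X \<union> Y = insert i (A \<union> B) \<or> X \<union> Y = A \<union> B \<and> insert i A \<in> F"
    using X Y by auto
  moreover have "insert i (A \<union> B) \<in> F" if "insert i A \<in> F"
    using union_closedD[OF union_closed that AB(2)] by simp
  ultimately show "X \<union> Y \<in> push_up i F ` F"
    unfolding push_up_image using union_closedD[OF union_closed AB] by auto
qed

lemma up_shift_push_up:
  assumes union_closed: "union_closed F"
  shows "up_shift F (push_up i F)"
proof (rule up_shiftI)
  show "A \<subseteq> push_up i F A" for A by (auto simp: push_up_def)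
next
  fix A B assume A: "A \<in> F" and B: "B \<in> F" "A \<subseteq> B"
  show "push_up i F A \<union> B \<in> push_up i F ` F"
  proof (cases "insert i A \<in> F")
    case True
    then have "insert i B \<in> F" using union_closedD[OF union_closed True B(1)] B(2)
      by (simp add: Un_absorb1)
    then show ?thesis
      unfolding push_up_image using True B by (simp add: push_up_def Un_absorb1)
  next
    case False
    then show ?thesis unfolding push_up_image using B by (simp add: push_up_def Un_absorb1)
  qed
  assume "B \<subseteq> push_up i F A"
  show "B = A"
  proof (cases "insert i A \<in> F")
    case True
    then show ?thesis using \<open>B \<subseteq> push_up i F A\<close> B(2) by (simp add: push_up_def)
  next
    case False
    then have "B \<subseteq> insert i A" using \<open>B \<subseteq> push_up i F A\<close> by (simp add: push_up_def)
    moreover have "B \<noteq> insert i A" using False B(1) by blast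
    ultimately show ?thesis using B(2) by blast
  qed
qed

lemma up_closed_on_push_up_image:
  assumes "up_closed_on I F"
  shows "up_closed_on (insert i I) (push_up i F ` F)"
  using assms unfolding up_closed_on_def push_up_image by (auto simp: insert_commute)

lemma ex_up_shift_up_closed:
  assumes "finite I" "union_closed F"
  shows "\<exists>f. up_shift F f \<and> up_closed_on I (f ` F) \<and> union_closed (f ` F) \<and> (\<forall>A. f A \<subseteq> A \<union> I)"
  using assms(1)
proof (induction I rule: finite_induct)
  case empty
  show ?case
    using \<open>union_closed F\<close>
    by (intro exI[of _ id] conjI up_shift_id) (simp_all add: up_closed_on_def)
next
  case (insert i I)
  then obtain f where shift: "up_shift F f" and up_closed: "up_closed_on I (f ` F)"
    and union_closed: "union_closed (f ` F)" and bounded: "\<forall>A. f A \<subseteq> A \<union> I" by blast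
  let ?g = "push_up i (f ` F) \<circ> f"
  have "up_shift F ?g" by (rule up_shift_comp[OF shift up_shift_push_up[OF union_closed]])
  moreover have "up_closed_on (insert i I) (?g ` F)" "union_closed (?g ` F)"
    using up_closed_on_push_up_image[OF up_closed] union_closed_push_up_image[OF union_closed]
    by (simp_all only: image_comp)
  moreover have "?g A \<subseteq> A \<union> insert i I" for A
    using push_up_subset_insert[of i "f ` F" "f A"] bounded by fastforce
  ultimately show ?case by blast
qed

section \<open>Reimer's theorem\<close>

lemma card_set_interval:
  fixes A B :: "'a set"
  assumes "finite B" "A \<subseteq> B"
  shows "card {A..B} = 2 ^ (card B - card A)"
proof -
  have "bij_betw (\<lambda>S. S \<union> A) (Pow (B - A)) {A..B}"
    by (rule bij_betw_byWitness[where f' = "\<lambda>S. S - A"]) (use assms in auto)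
  then have "card {A..B} = card (Pow (B - A))"
    by (metis bij_betw_same_card)
  then show ?thesis
    using assms by (simp add: card_Pow card_Diff_subset finite_subset)
qed

lemma sum_log_le_log_average:
  fixes x :: "'a \<Rightarrow> real"
  assumes "finite S" "S \<noteq> {}" "b > 1" "\<And>i. i \<in> S \<Longrightarrow> x i > 0"
  shows "(\<Sum>i\<in>S. log b (x i)) \<le> card S * log b ((\<Sum>i\<in>S. x i) / card S)"
proof -
  have card_pos: "real (card S) > 0" using assms by (simp add: card_gt_0_iff)
  have "(\<Sum>i\<in>S. 1 / card S * log b (x i)) \<le> log b (\<Sum>i\<in>S. (1 / card S) *\<^sub>R x i)"
    using assms card_pos by (intro concave_on_sum[OF _ _ log_concave]) auto
  then show ?thesis
    using card_pos by (simp add: field_simps flip: sum_divide_distrib)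
qed

lemma sum_log_card_disjoint_le:
  assumes "finite I" "I \<noteq> {}" "finite S" "b > 1"
    and disjoint: "disjoint_family_on J I" and nonempty: "\<And>i. i \<in> I \<Longrightarrow> J i \<noteq> {}"
    and sub: "\<And>i. i \<in> I \<Longrightarrow> J i \<subseteq> S"
  shows "(\<Sum>i\<in>I. log b (card (J i))) \<le> card I * log b (card S / card I)"
proof -
  have fin: "finite (J i)" if "i \<in> I" for i using sub[OF that] \<open>finite S\<close> finite_subset by blast
  have pos: "real (card (J i)) > 0" if "i \<in> I" for i
    using nonempty[OF that] fin[OF that] by (simp add: card_gt_0_iff)
  have "(\<Sum>i\<in>I. card (J i)) = card (\<Union>i\<in>I. J i)"
    by (rule card_UN_disjoint'[symmetric]) (use disjoint fin assms in auto)
  also have "\<dots> \<le> card S" using sub \<open>finite S\<close> by (intro card_mono) auto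
  finally have "(\<Sum>i\<in>I. real (card (J i))) \<le> card S" by (metis of_nat_le_iff of_nat_sum)
  then have "log b ((\<Sum>i\<in>I. real (card (J i))) / card I) \<le> log b (card S / card I)"
    using assms pos by (intro log_mono) (auto simp: card_gt_0_iff sum_pos intro!: divide_right_mono)
  then show ?thesis
    using sum_log_le_log_average[of I b "\<lambda>i. real (card (J i))"] pos assms
    by (meson mult_left_mono of_nat_0_le_iff order_trans)
qed

lemma sum_card_diff_disjoint_intervals_le:
  fixes L U :: "'i \<Rightarrow> 'a set"
  assumes "finite I" "I \<noteq> {}" and fin: "finite S"
    and disjoint: "disjoint_family_on (\<lambda>i. {L i..U i}) I"
    and sub: "\<And>i. i \<in> I \<Longrightarrow> L i \<subseteq> U i" "\<And>i. i \<in> I \<Longrightarrow> U i \<subseteq> S"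
  shows "(\<Sum>i\<in>I. real (card (U i)) - card (L i)) \<le> card I * (card S - log 2 (card I))"
proof -
  have "log 2 (card {L i..U i}) = real (card (U i)) - card (L i)" if "i \<in> I" for i
    using sub[OF that] finite_subset[OF sub(2)[OF that] fin]
    by (simp add: card_set_interval log_nat_power card_mono of_nat_diff)
  then have "(\<Sum>i\<in>I. real (card (U i)) - card (L i)) = (\<Sum>i\<in>I. log 2 (card {L i..U i}))"
    by simp
  also have "\<dots> \<le> card I * log 2 (card (Pow S) / card I)"
  proof (rule sum_log_card_disjoint_le[OF assms(1,2) _ _ disjoint])
    show "{L i..U i} \<noteq> {}" if "i \<in> I" for i using sub(1)[OF that] by simp
    show "{L i..U i} \<subseteq> Pow S" if "i \<in> I" for i using sub(2)[OF that] by fastforce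
  qed (use fin in simp_all)
  also have "\<dots> = card I * (card S - log 2 (card I))"
    using assms(1,2) fin by (simp add: card_gt_0_iff card_Pow log_divide log_nat_power)
  finally show ?thesis .
qed

lemma insert_up_shift_mem_image:
  assumes shift: "up_shift F f" and union_closed: "union_closed F"
    and A: "A \<in> F" "i \<notin> f A" and "insert i (f A) \<in> f ` F"
  shows "insert i (f A) \<in> f ` {B \<in> F. i \<in> B}"
proof -
  obtain B where B: "B \<in> F" "f B = insert i (f A)" using assms(5) by auto
  have "i \<in> B"
  proof (rule ccontr)
    assume "i \<notin> B"
    then have "B \<subseteq> f A" using up_shift_subset[OF shift B(1)] B(2) by auto
    then have "A = B" using up_shift_eqI[OF shift union_closed A(1) B(1)] B(2) by blast
    then have "i \<in> f A" using B(2) by blast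
    then show False using A(2) by simp
  qed
  then have "f B \<in> f ` {B \<in> F. i \<in> B}" using B(1) by blast
  then show ?thesis by (simp only: B(2))
qed

lemma card_not_mem_up_shift_le:
  assumes "finite F" and shift: "up_shift F f" and union_closed: "union_closed F"
    and up_closed: "up_closed_on {i} (f ` F)"
  shows "card {A \<in> F. i \<notin> f A} \<le> card {A \<in> F. i \<in> A}"
proof -
  let ?N = "{A \<in> F. i \<notin> f A}"
  have "inj_on (\<lambda>A. insert i (f A)) ?N"
    using inj_on_up_shift[OF shift union_closed] by (simp add: inj_on_def insert_ident)
  moreover have "(\<lambda>A. insert i (f A)) ` ?N \<subseteq> f ` {A \<in> F. i \<in> A}"
  proof (rule image_subsetI)
    fix A assume "A \<in> ?N"
    then show "insert i (f A) \<in> f ` {A \<in> F. i \<in> A}"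
      using up_closed
      by (intro insert_up_shift_mem_image[OF shift union_closed]) (simp_all add: up_closed_on_def)
  qed
  ultimately have "card ?N \<le> card (f ` {A \<in> F. i \<in> A})"
    using \<open>finite F\<close> by (intro card_inj_on_le[where f = "\<lambda>A. insert i (f A)"]) auto
  also have "\<dots> \<le> card {A \<in> F. i \<in> A}" using \<open>finite F\<close> by (intro card_image_le) simp
  finally show ?thesis .
qed

lemma sum_card_Diff_up_shift_le:
  assumes fin: "finite F" "finite (\<Union>F)"
    and shift: "up_shift F f" and union_closed: "union_closed F"
    and up_closed: "up_closed_on (\<Union>F) (f ` F)"
  shows "(\<Sum>A\<in>F. card (\<Union>F - f A)) \<le> (\<Sum>A\<in>F. card A)"
proof -
  have "(\<Sum>A\<in>F. card (\<Union>F - f A)) = (\<Sum>i\<in>\<Union>F. card {A \<in> F. i \<notin> f A})"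
    unfolding set_diff_eq by (rule sum_multicount_gen[OF fin]) simp
  also have "\<dots> \<le> (\<Sum>i\<in>\<Union>F. card {A \<in> F. i \<in> A})"
    using up_closed
    by (intro sum_mono card_not_mem_up_shift_le[OF fin(1) shift union_closed])
      (unfold up_closed_on_def, blast)
  also have "\<dots> = (\<Sum>A\<in>F. card {i \<in> \<Union>F. i \<in> A})"
    by (rule sum_multicount_gen[OF fin, symmetric]) simp
  also have "\<dots> = (\<Sum>A\<in>F. card A)"
    by (intro sum.cong arg_cong[where f = card]) auto
  finally show ?thesis .
qed

theorem reimer_sum_card_ge:
  assumes "union_closed_family F" and ne: "F \<noteq> {}"
  shows "card F * log 2 (card F) / 2 \<le> (\<Sum>A\<in>F. real (card A))"
proof -
  let ?n = "real (card (\<Union>F))" and ?m = "real (card F)"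
  have fin: "finite F" "finite (\<Union>F)" and union_closed: "union_closed F"
    using assms(1) by (simp_all add: union_closed_family_iff)
  obtain f where shift: "up_shift F f" and up_closed: "up_closed_on (\<Union>F) (f ` F)"
    and bounded: "\<forall>A. f A \<subseteq> A \<union> \<Union>F"
    using ex_up_shift_up_closed[OF fin(2) union_closed] by blast
  have sub: "A \<subseteq> f A" "f A \<subseteq> \<Union>F" if "A \<in> F" for A
    using up_shift_subset[OF shift that] bounded that by blast+
  have "(\<Sum>A\<in>F. real (card (\<Union>F - f A))) \<le> (\<Sum>A\<in>F. real (card A))"
    using sum_card_Diff_up_shift_le[OF fin shift union_closed up_closed]
    by (metis of_nat_le_iff of_nat_sum)
  moreover have "real (card (\<Union>F - f A)) = ?n - card (f A)" if "A \<in> F" for A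
    using sub(2)[OF that] finite_subset[OF sub(2)[OF that] fin(2)] fin
    by (simp add: card_Diff_subset card_mono of_nat_diff)
  ultimately have "?m * ?n - (\<Sum>A\<in>F. real (card (f A))) \<le> (\<Sum>A\<in>F. real (card A))"
    by (simp add: sum_subtractf)
  moreover have "(\<Sum>A\<in>F. real (card (f A)) - card A) \<le> ?m * (?n - log 2 ?m)"
    using up_shift_disjoint_intervals[OF shift union_closed] sub fin ne
    by (intro sum_card_diff_disjoint_intervals_le)
  ultimately show ?thesis
    by (simp add: sum_subtractf algebra_simps)
qed

section \<open>Families with fewer members than elements\<close>

theorem bondy_ex_separating_set:
  assumes "finite F" "F \<noteq> {}"
  shows "\<exists>T \<subseteq> \<Union>F. finite T \<and> card T < card F \<and> inj_on (\<lambda>A. A \<inter> T) F"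
  using assms
proof (induction F rule: finite_ne_induct)
  case (singleton A)
  show ?case by (intro exI[of _ "{}"]) simp
next
  case (insert A F)
  then obtain T where T: "T \<subseteq> \<Union>F" "finite T" "card T < card F" and inj: "inj_on (\<lambda>A. A \<inter> T) F"
    by blast
  show ?case
  proof (cases "\<exists>B\<in>F. B \<inter> T = A \<inter> T")
    case False
    then have "inj_on (\<lambda>A. A \<inter> T) (insert A F)" using inj unfolding inj_on_insert by blast
    then show ?thesis using T insert.hyps by (intro exI[of _ T]) auto
  next
    case True
    then obtain B where B: "B \<in> F" "B \<inter> T = A \<inter> T" by blast
    then have "A \<noteq> B" using insert.hyps by blast
    then obtain x where x: "x \<in> A \<union> B" "x \<in> A \<longleftrightarrow> x \<notin> B" by blast
    have restrict: "C \<inter> T = D \<inter> T" if "C \<inter> insert x T = D \<inter> insert x T" for C D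
      using that by blast
    have "C \<inter> insert x T \<noteq> A \<inter> insert x T" if "C \<in> F" for C
    proof
      assume eq: "C \<inter> insert x T = A \<inter> insert x T"
      then have "C \<inter> T = B \<inter> T" using restrict[OF eq] B(2) by simp
      then have "C = B" using inj_onD[OF inj] B(1) that by simp
      then show False using eq x by blast
    qed
    moreover have "inj_on (\<lambda>A. A \<inter> insert x T) F"
      by (rule inj_onI) (rule inj_onD[OF inj restrict])
    ultimately have "inj_on (\<lambda>A. A \<inter> insert x T) (insert A F)"
      unfolding inj_on_insert by blast
    moreover have "card (insert x T) < card (insert A F)"
      using T insert.hyps by (simp add: card_insert_if)
    ultimately show ?thesis using T x B by (intro exI[of _ "insert x T"]) auto
  qed
qed

lemma sum_card_trace_add_card_Diff_le:
  assumes "finite F" "finite (\<Union>F)"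
  shows "(\<Sum>A\<in>F. card (A \<inter> T)) + card (\<Union>F - T) \<le> (\<Sum>A\<in>F. card A)"
proof -
  have "\<Union>F - T = (\<Union>A\<in>F. A - T)" by blast
  then have "card (\<Union>F - T) \<le> (\<Sum>A\<in>F. card (A - T))"
    using card_UN_le[OF assms(1), of "\<lambda>A. A - T"] by simp
  moreover have "(\<Sum>A\<in>F. card A) = (\<Sum>A\<in>F. card (A \<inter> T) + card (A - T))"
    using assms by (intro sum.cong card_Int_Diff) (auto intro: finite_subset)
  ultimately show ?thesis by (simp add: sum.distrib)
qed

lemma union_closed_family_trace:
  assumes "union_closed_family F"
  shows "union_closed_family ((\<lambda>A. A \<inter> T) ` F)"
  using assms by (auto simp: union_closed_family_def simp flip: Int_Un_distrib2)

lemma sum_card_ge_reimer_add_excess: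
  assumes "union_closed_family F" and ne: "F \<noteq> {}"
  shows "card F * log 2 (card F) / 2 + (real (card (\<Union>F)) - card F) \<le> (\<Sum>A\<in>F. real (card A))"
proof -
  have fin: "finite F" "finite (\<Union>F)" using assms by (simp_all add: union_closed_family_iff)
  obtain T where T: "T \<subseteq> \<Union>F" "finite T" "card T < card F" and inj: "inj_on (\<lambda>A. A \<inter> T) F"
    using bondy_ex_separating_set[OF fin(1) ne] by blast
  have "card F * log 2 (card F) / 2 \<le> (\<Sum>A\<in>F. real (card (A \<inter> T)))"
    using reimer_sum_card_ge[OF union_closed_family_trace[OF assms(1), of T]] ne
    by (simp add: card_image[OF inj] sum.reindex[OF inj])
  moreover have "real (card (\<Union>F)) - card F \<le> card (\<Union>F - T)"
    using T fin by (simp add: card_Diff_subset card_mono of_nat_diff)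
  moreover have "(\<Sum>A\<in>F. real (card (A \<inter> T))) + card (\<Union>F - T) \<le> (\<Sum>A\<in>F. real (card A))"
    using sum_card_trace_add_card_Diff_le[OF fin, of T]
    by (metis of_nat_add of_nat_le_iff of_nat_sum)
  ultimately show ?thesis by linarith
qed

section \<open>The density bound\<close>

lemma half_log2_le:
  fixes r :: real
  assumes "r \<ge> 1"
  shows "log 2 r / 2 \<le> r - 1"
proof -
  have half: "1 / 2 \<le> ln (2::real)" using ln_le_minus_one[of "1 / 2 :: real"] by (simp add: ln_div)
  have "ln r \<le> r - 1" using assms by (intro ln_le_minus_one) simp
  also have "\<dots> \<le> (r - 1) * (2 * ln 2)"
    using mult_left_mono[of 1 "2 * ln 2" "r - 1"] half assms by simp
  finally show ?thesis by (simp add: log_def field_simps)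
qed

lemma sum_card_ge_log_card_Union:
  assumes union_closed: "union_closed_family F" and ne: "\<Union>F \<noteq> {}"
  shows "card F * log 2 (card (\<Union>F)) / 2 \<le> (\<Sum>A\<in>F. real (card A))"
proof -
  let ?m = "real (card F)" and ?n = "real (card (\<Union>F))"
  have "finite F" "finite (\<Union>F)" "F \<noteq> {}" using union_closed ne
    by (auto simp: union_closed_family_iff)
  then have card_pos: "?m > 0" and card_Union_pos: "?n > 0" using ne
    by (simp_all add: card_gt_0_iff del: Union_empty_conv)
  show ?thesis
  proof (cases "?n \<le> ?m")
    case True
    then have "?m * log 2 ?n / 2 \<le> ?m * log 2 ?m / 2" using card_pos card_Union_pos by simp
    then show ?thesis using reimer_sum_card_ge[OF union_closed \<open>F \<noteq> {}\<close>] by linarith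
  next
    case False
    then have "?m * (log 2 (?n / ?m) / 2) \<le> ?m * (?n / ?m - 1)"
      using card_pos by (intro mult_left_mono half_log2_le) (simp_all add: field_simps)
    then have "?m * (log 2 ?n - log 2 ?m) / 2 \<le> ?n - ?m"
      using card_pos card_Union_pos by (simp add: log_divide right_diff_distrib)
    then show ?thesis using sum_card_ge_reimer_add_excess[OF union_closed \<open>F \<noteq> {}\<close>]
      by (simp add: right_diff_distrib diff_divide_distrib)
  qed
qed

lemma family_density_ge:
  assumes union_closed: "union_closed_family F" and card_Union: "card (\<Union>F) = n" "n \<ge> 1"
  shows "family_density F \<ge> log 2 (real n) / (2 * real n)"
proof -
  have ne: "\<Union>F \<noteq> {}" using card_Union by (metis card.empty not_one_le_zero)
  then have "finite F" "F \<noteq> {}" using union_closed by (auto simp: union_closed_family_iff)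
  then have "real (card F) > 0" by (simp add: card_gt_0_iff)
  then show ?thesis
    using sum_card_ge_log_card_Union[OF union_closed ne] card_Union
    by (simp add: family_density_def field_simps)
qed

theorem theorem3:
  fixes n :: nat
  assumes "n \<ge> 1"
  shows "(\<forall>F :: 'a set set. union_closed_family F \<and> card (\<Union>F) = n \<longrightarrow>
            family_density F \<ge> log 2 (real n) / (2 * real n))
       \<and> min_density n \<ge> log 2 (real n) / (2 * real n)"
proof
  show "\<forall>F :: 'a set set. union_closed_family F \<and> card (\<Union>F) = n \<longrightarrow>
            family_density F \<ge> log 2 (real n) / (2 * real n)"
    using family_density_ge assms by blast
  have "\<forall>x\<in>densities n. log 2 (real n) / (2 * real n) \<le> x"
    using family_density_ge assms unfolding densities_def by blast
  then show "min_density n \<ge> log 2 (real n) / (2 * real n)"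
    unfolding min_density_def by (simp add: finite_densities densities_nonempty)
qed

end
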